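(* Let $\nu>0$ and $\lambda\ge 0$, and suppose that the noncentral $\chi^2$ density $p_{\nu,\lambda}$ has an interior mode $M(\nu,\lambda)\in(0,\infty)$. Then $$\lambda+\nu-4<M(\nu,\lambda).$$ Moreover: if $\nu\ge 2$, then $$(\nu-2)\left(1+\frac{\lambda}{\nu}\right)\le M(\nu,\lambda)\le\lambda+\nu-2;$$ if $\nu>3$, then $$\lambda+\nu-3<M(\nu,\lambda);$$ and if $0<\nu<2$ and $\lambda>\lambda_\nu$, then $$M(\nu,\lambda)<\lambda+\nu-3,$$ where $\lambda_\nu$ is the critical value defined in the context.
   Context: Densities. For $\nu>0$ and $x>0$ let $p_{\nu,0}(x)=\frac{e^{-x/2}}{2\Gamma(\nu/2)}\left(\frac{x}{2}\right)^{\nu/2-1}$. For $\lambda\ge 0$ (with $0^0=1$) let $$p_{\nu,\lambda}(x)=\sum_{k=0}^\infty \frac{e^{-\lambda/2}}{k!}\left(\frac{\lambda}{2}\right)^k p_{\nu+2k,0}(x),\quad x>0,$$ the noncentral $\chi^2$ density with $\nu$ degrees of freedom ($\nu$ need not be an integer) and noncentrality parameter $\lambda$. Interior mode. An interior mode of $p_{\nu,\lambda}$ is a point of $(0,\infty)$ at which $p_{\nu,\lambda}$ has a local maximum; $M(\nu,\lambda)$ denotes the interior mode (it is unique when it exists). Critical value. Let $I_\mu(x)=\sum_{k=0}^\infty \frac{(x/2)^{2k+\mu}}{k!\,\Gamma(\mu+k+1)}$ be the modified Bessel function of the first kind, and $r_\mu(x)=I_\mu(x)/I_{\mu-1}(x)$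 for $\mu>0$, $x>0$. For $\nu\in(0,2)$ and $\lambda>4-\nu$ let $$g_\nu(\lambda)=r_{\nu/2}\left(\sqrt{\lambda(\lambda+\nu-4)}\right)-\frac{\lambda-2}{\sqrt{\lambda(\lambda+\nu-4)}}.$$ For $\nu\in(0,2)$, $\lambda_\nu$ is the unique number in $(4-\nu,\infty)$ such that $g_\nu(\lambda)>0$ for $\lambda>\lambda_\nu$ and $g_\nu(\lambda)<0$ for $4-\nu<\lambda<\lambda_\nu$. *)

theory Defs
  imports "HOL-Analysis.Analysis"
begin

definition chi2_density :: "real \<Rightarrow> real \<Rightarrow> real" where
  "chi2_density \<nu> x = exp (- x / 2) / (2 * Gamma (\<nu> / 2)) * (x / 2) powr (\<nu> / 2 - 1)"

definition nc_chi2_density :: "real \<Rightarrow> real \<Rightarrow> real \<Rightarrow> real" where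
  "nc_chi2_density \<nu> lam x =
     (\<Sum>k. exp (- lam / 2) / fact k * (lam / 2) ^ k * chi2_density (\<nu> + 2 * real k) x)"

text \<open>The densities are only meaningful for positive arguments, so the local maximum is
  taken relative to the open half-line.\<close>

definition interior_mode :: "real \<Rightarrow> real \<Rightarrow> real \<Rightarrow> bool" where
  "interior_mode \<nu> lam m \<longleftrightarrow>
     0 < m \<and> (\<forall>\<^sub>F x in at m within {0<..}. nc_chi2_density \<nu> lam x \<le> nc_chi2_density \<nu> lam m)"

text \<open>Intended for orders greater than \<open>-1\<close> and positive arguments, where every Gamma value
  in the series is taken at a positive point.\<close>

definition bessel_I :: "real \<Rightarrow> real \<Rightarrow> real" where
  "bessel_I \<mu> x = (\<Sum>k. (x / 2) powr (2 * real k + \<mu>) / (fact k * Gamma (\<mu> + real k + 1)))"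

definition bessel_ratio :: "real \<Rightarrow> real \<Rightarrow> real" where
  "bessel_ratio \<mu> x = bessel_I \<mu> x / bessel_I (\<mu> - 1) x"

definition crit_fun :: "real \<Rightarrow> real \<Rightarrow> real" where
  "crit_fun \<nu> lam = bessel_ratio (\<nu> / 2) (sqrt (lam * (lam + \<nu> - 4)))
     - (lam - 2) / sqrt (lam * (lam + \<nu> - 4))"

text \<open>For \<open>0 < \<nu> < 2\<close> the number described here exists and is unique.\<close>

definition crit_value :: "real \<Rightarrow> real" where
  "crit_value \<nu> = (THE L. 4 - \<nu> < L \<and> (\<forall>lam>L. 0 < crit_fun \<nu> lam) \<and>
     (\<forall>lam. 4 - \<nu> < lam \<and> lam < L \<longrightarrow> crit_fun \<nu> lam < 0))"

end

theory Submission imports Defs begin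

text \<open>With \<open>a = \<nu>/2\<close>, \<open>l = lam/2\<close> and \<open>y = x/2\<close>, the density is a constant multiple of
  \<open>exp (-y) y\<^bsup>a-1\<^esup> F(l y)\<close>, where \<open>F\<close> is the confluent hypergeometric limit function
  \<open>\<^sub>0F\<^sub>1(;a;\<cdot>)\<close>. Its logarithmic derivative \<open>\<phi>(t) = t F'(t) / F(t)\<close> solves the Riccati equation
  \<open>t \<phi>' = t + (1 - a) \<phi> - \<phi>\<^sup>2\<close>, and the stationary points of the density are the solutions of
  \<open>\<phi>(l y) + a - 1 = y\<close>. Every bound except the first says that a quadratic polynomial in \<open>\<phi>\<close> and \<open>t\<close>
  keeps its sign at \<open>t = l y\<close>; by the Riccati equation such a polynomial cannot cross zero in the wrong
  direction. For the first bound, the same equation shows that the logarithmic derivative of the density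
  increases through zero at every stationary point \<open>y < l + a - 2\<close>, and has a local maximum with
  value zero if \<open>y = l + a - 2\<close> is stationary.\<close>

subsection \<open>Sign preservation\<close>

text \<open>The smallest zero would be reached from positive values, which a positive slope there
  forbids.\<close>

lemma pos_if_deriv_pos_at_zeros:
  fixes f f' :: "real \<Rightarrow> real"
  assumes deriv: "\<And>t. t \<ge> 0 \<Longrightarrow> (f has_real_derivative f' t) (at t)"
    and pos0: "f 0 > 0"
    and zeros: "\<And>t. t > 0 \<Longrightarrow> f t = 0 \<Longrightarrow> f' t > 0"
    and "t \<ge> 0"
  shows "f t > 0"
proof (rule ccontr)
  assume "\<not> f t > 0"
  have cont: "continuous_on {0..s} f" for s
    by (meson DERIV_continuous atLeastAtMost_iff continuous_at_imp_continuous_on deriv)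
  define S where "S = {s \<in> {0..t}. f s = 0}"
  have zero_below: "\<exists>u\<in>S. u \<le> s" if "0 \<le> s" "s \<le> t" "f s \<le> 0" for s
    using IVT2'[of f s 0 0] that pos0 cont[of s] by (auto simp: S_def)
  have "closed S"
    unfolding S_def using continuous_closed_preimage_constant[OF cont closed_atLeastAtMost] .
  moreover have "bounded S"
    by (rule bounded_subset[of "{0..t}"]) (auto simp: S_def)
  moreover have "S \<noteq> {}"
    using zero_below[of t] \<open>\<not> f t > 0\<close> \<open>t \<ge> 0\<close> by auto
  ultimately obtain s where s: "s \<in> S" "\<And>u. u \<in> S \<Longrightarrow> s \<le> u"
    using compact_attains_inf[of S] by (auto simp: compact_eq_bounded_closed)
  have "s > 0" "f s = 0" "s \<le> t"
    using s(1) pos0 by (auto simp: S_def order.order_iff_strict)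
  \<comment> \<open>The positive slope makes \<open>f\<close> negative just left of
    \<open>s\<close>, so by the intermediate value theorem a zero lies before the smallest
    one.\<close>
  then obtain d where d: "d > 0" "\<And>h. h > 0 \<Longrightarrow> h < d \<Longrightarrow> f (s - h) < f s"
    using DERIV_pos_inc_left[of f "f' s" s] deriv[of s] zeros[of s] by auto
  define h where "h = min d s / 2"
  have "h > 0" "h < d" "h < s"
    using \<open>d > 0\<close> \<open>s > 0\<close> by (auto simp: h_def)
  then have "\<exists>u\<in>S. u \<le> s - h"
    using zero_below[of "s - h"] d(2)[of h] \<open>f s = 0\<close> \<open>s \<le> t\<close> by auto
  then show False
    using s(2) \<open>h > 0\<close> by fastforce
qed

text \<open>If \<open>f t < 0\<close>, then \<open>f\<close> is negative from the last point
  \<open>s\<close> of \<open>{0..t}\<close> with \<open>f s >= 0\<close> up to \<open>t\<close>, so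
  it cannot decrease there. Unlike the previous lemma, this allows \<open>f 0 = 0\<close>, as the
  Turan quantities below require.\<close>

lemma nonneg_if_deriv_nonneg_when_neg:
  fixes f f' :: "real \<Rightarrow> real"
  assumes deriv: "\<And>t. t \<ge> 0 \<Longrightarrow> (f has_real_derivative f' t) (at t)"
    and nonneg0: "f 0 \<ge> 0"
    and neg: "\<And>t. t > 0 \<Longrightarrow> f t < 0 \<Longrightarrow> f' t \<ge> 0"
    and "t \<ge> 0"
  shows "f t \<ge> 0"
proof (rule ccontr)
  assume "\<not> f t \<ge> 0"
  have cont: "continuous_on {0..t} f"
    by (meson DERIV_continuous atLeastAtMost_iff continuous_at_imp_continuous_on deriv)
  define S where "S = {s \<in> {0..t}. f s \<ge> 0}"
  have "S = {0..t} \<inter> f -` {0..}"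
    by (auto simp: S_def)
  then have "closed S"
    using continuous_closed_preimage[OF cont closed_atLeastAtMost closed_atLeast] by simp
  moreover have "bounded S"
    by (rule bounded_subset[of "{0..t}"]) (auto simp: S_def)
  moreover have "0 \<in> S"
    using nonneg0 \<open>t \<ge> 0\<close> by (auto simp: S_def)
  ultimately obtain s where s: "s \<in> S" "\<And>u. u \<in> S \<Longrightarrow> u \<le> s"
    using compact_attains_sup[of S] by (auto simp: compact_eq_bounded_closed)
  have "s \<ge> 0" "f s \<ge> 0" "s < t"
    using s(1) \<open>\<not> f t \<ge> 0\<close> by (auto simp: S_def order.order_iff_strict)
  then obtain z where z: "s < z" "z < t" "f t - f s = (t - s) * f' z"
    using MVT2[of s t f f'] deriv by auto
  have "f z < 0"
    using s(2)[of z] z \<open>s \<ge> 0\<close> by (force simp: S_def)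
  then have "(t - s) * f' z \<ge> 0"
    using neg[of z] z \<open>s \<ge> 0\<close> by auto
  then show False
    using z(3) \<open>f s \<ge> 0\<close> \<open>\<not> f t \<ge> 0\<close> by linarith
qed

subsection \<open>The confluent hypergeometric limit function\<close>

definition hyp0F1_coeff :: "real \<Rightarrow> nat \<Rightarrow> real" where
  "hyp0F1_coeff a k = 1 / (fact k * pochhammer a k)"

definition hyp0F1 :: "real \<Rightarrow> real \<Rightarrow> real" where
  "hyp0F1 a t = (\<Sum>k. hyp0F1_coeff a k * t ^ k)"

definition hyp0F1' :: "real \<Rightarrow> real \<Rightarrow> real" where
  "hyp0F1' a t = (\<Sum>k. diffs (hyp0F1_coeff a) k * t ^ k)"

text \<open>Each factor \<open>a + i\<close> of the rising factorial is at least \<open>a\<close>.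
  This lets an exponential series dominate the series of \<open>hyp0F1\<close>.\<close>

lemma power_le_pochhammer:
  fixes a :: "'a :: linordered_semidom"
  assumes "a \<ge> 0"
  shows "a ^ k \<le> pochhammer a k"
proof (induction k)
  case (Suc k)
  have "pochhammer a k \<ge> 0"
    by (rule order_trans[OF zero_le_power Suc]) (rule assms)
  then have "a ^ k * a \<le> pochhammer a k * (a + of_nat k)"
    by (intro mult_mono) (use Suc assms in auto)
  then show ?case
    by (simp add: pochhammer_Suc mult.commute)
qed simp

context
  fixes a :: real
  assumes a: "a > 0"
begin

lemma hyp0F1_coeff_pos: "hyp0F1_coeff a k > 0"
  using a by (simp add: hyp0F1_coeff_def pochhammer_pos)

text \<open>This is the differential equation \<open>t F'' + a F' = F\<close>, read off at the
  coefficient of \<open>t ^ k\<close>.\<close>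

lemma diffs_hyp0F1_coeff: "(a + real k) * diffs (hyp0F1_coeff a) k = hyp0F1_coeff a k"
proof -
  have "a + real k \<noteq> 0" "1 + real k \<noteq> 0" "pochhammer a k \<noteq> 0"
    using pochhammer_pos[OF a, of k] a by linarith+
  then show ?thesis
    by (simp add: diffs_def hyp0F1_coeff_def pochhammer_Suc del: of_nat_Suc of_nat_add)
qed

lemma diffs_hyp0F1_coeff_pos: "diffs (hyp0F1_coeff a) k > 0"
  using hyp0F1_coeff_pos[of "Suc k"] by (simp add: diffs_def)

lemma summable_hyp0F1: "summable (\<lambda>k. hyp0F1_coeff a k * t ^ k)"
proof (rule summable_comparison_test')
  show "summable (\<lambda>k. inverse (fact k) * (\<bar>t\<bar> / a) ^ k)"
    by (rule summable_exp)
  fix k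
  have "1 / pochhammer a k \<le> 1 / a ^ k"
    using a power_le_pochhammer[of a k] by (intro divide_left_mono) (auto simp: pochhammer_pos)
  then have "\<bar>t\<bar> ^ k / fact k * (1 / pochhammer a k) \<le> \<bar>t\<bar> ^ k / fact k * (1 / a ^ k)"
    by (rule mult_left_mono) simp
  moreover have "pochhammer a k > 0"
    using a by (rule pochhammer_pos)
  ultimately show "norm (hyp0F1_coeff a k * t ^ k) \<le> inverse (fact k) * (\<bar>t\<bar> / a) ^ k"
    by (simp add: hyp0F1_coeff_def abs_mult power_abs power_divide field_simps)
qed

lemma summable_hyp0F1': "summable (\<lambda>k. diffs (hyp0F1_coeff a) k * t ^ k)"
  using termdiff_converges_all[OF summable_hyp0F1] .

lemma DERIV_hyp0F1: "(hyp0F1 a has_real_derivative hyp0F1' a t) (at t)"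
  unfolding hyp0F1_def[abs_def] hyp0F1'_def
  by (rule termdiffs_strong_converges_everywhere[OF summable_hyp0F1])

lemma hyp0F1_pos:
  assumes "t \<ge> 0"
  shows "hyp0F1 a t > 0"
  unfolding hyp0F1_def
  by (rule suminf_pos2[where i = 0])
    (use assms hyp0F1_coeff_pos in \<open>auto simp: summable_hyp0F1 less_imp_le\<close>)

lemma hyp0F1'_nonneg:
  assumes "t \<ge> 0"
  shows "hyp0F1' a t \<ge> 0"
  unfolding hyp0F1'_def
  by (rule suminf_nonneg[OF summable_hyp0F1'])
    (use assms diffs_hyp0F1_coeff_pos in \<open>simp add: less_imp_le\<close>)

lemma hyp0F1_ODE:
  obtains D where "(hyp0F1' a has_real_derivative D) (at t)"
    and "t * D + a * hyp0F1' a t = hyp0F1 a t"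
proof
  define c where "c = diffs (hyp0F1_coeff a)"
  define D where "D = (\<Sum>k. diffs c k * t ^ k)"
  have summ: "summable (\<lambda>k. c k * u ^ k)" for u
    using summable_hyp0F1' by (simp add: c_def)
  show "(hyp0F1' a has_real_derivative D) (at t)"
    unfolding hyp0F1'_def[abs_def] D_def c_def[symmetric]
    by (rule termdiffs_strong_converges_everywhere[OF summ])
  have "(\<lambda>k. t * (diffs c k * t ^ k)) sums (t * D)"
    unfolding D_def by (intro sums_mult summable_sums termdiff_converges_all summ)
  then have "(\<lambda>k. real (Suc k) * c (Suc k) * t ^ Suc k) sums (t * D)"
    by (simp add: diffs_def algebra_simps)
  \<comment> \<open>The term at index 0 vanishes through its factor \<open>real k\<close>, so
    undoing the index shift adds nothing.\<close>
  then have "(\<lambda>k. real k * c k * t ^ k) sums (t * D)"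
    by (subst (asm) sums_Suc_iff) simp
  moreover have "(\<lambda>k. a * (c k * t ^ k)) sums (a * hyp0F1' a t)"
    unfolding hyp0F1'_def c_def[symmetric] by (intro sums_mult summable_sums summ)
  ultimately have "(\<lambda>k. real k * c k * t ^ k + a * (c k * t ^ k)) sums (t * D + a * hyp0F1' a t)"
    by (rule sums_add)
  moreover have "real k * c k * t ^ k + a * (c k * t ^ k) = hyp0F1_coeff a k * t ^ k" for k
    using diffs_hyp0F1_coeff[of k, symmetric] by (simp add: c_def algebra_simps)
  ultimately show "t * D + a * hyp0F1' a t = hyp0F1 a t"
    unfolding hyp0F1_def by (simp add: sums_iff)
qed

end

subsection \<open>The Riccati equation and its consequences\<close>

definition hyp0F1_logderiv :: "real \<Rightarrow> real \<Rightarrow> real" where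
  "hyp0F1_logderiv a t = t * hyp0F1' a t / hyp0F1 a t"

context
  fixes a :: real
  assumes a: "a > 0"
begin

lemma hyp0F1_logderiv_0 [simp]: "hyp0F1_logderiv a 0 = 0"
  by (simp add: hyp0F1_logderiv_def)

lemma hyp0F1_logderiv_nonneg: "t \<ge> 0 \<Longrightarrow> hyp0F1_logderiv a t \<ge> 0"
  using hyp0F1_pos[OF a, of t] hyp0F1'_nonneg[OF a, of t] by (simp add: hyp0F1_logderiv_def)

text \<open>Keeping the factor \<open>t\<close> on the left covers the singular point
  \<open>t = 0\<close>, where both sides vanish.\<close>

lemma hyp0F1_logderiv_Riccati:
  assumes "t \<ge> 0"
  obtains D where "(hyp0F1_logderiv a has_real_derivative D) (at t)"
    and "t * D = t + (1 - a) * hyp0F1_logderiv a t - (hyp0F1_logderiv a t)\<^sup>2"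
proof -
  obtain E where E: "(hyp0F1' a has_real_derivative E) (at t)"
      "t * E + a * hyp0F1' a t = hyp0F1 a t"
    using hyp0F1_ODE[OF a] .
  have pos: "hyp0F1 a t > 0"
    using hyp0F1_pos[OF a assms] .
  have "((\<lambda>t. t * hyp0F1' a t / hyp0F1 a t) has_real_derivative
      ((1 * hyp0F1' a t + E * t) * hyp0F1 a t - t * hyp0F1' a t * hyp0F1' a t)
        / (hyp0F1 a t * hyp0F1 a t)) (at t)"
    by (rule DERIV_divide[OF DERIV_mult'[OF DERIV_ident E(1), THEN DERIV_cong] DERIV_hyp0F1[OF a]])
      (use pos in \<open>auto simp: algebra_simps\<close>)
  \<comment> \<open>The second derivative enters the quotient rule only as \<open>E * t\<close>, so
    the differential equation eliminates it without division by \<open>t\<close>.\<close>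
  moreover have "E * t = hyp0F1 a t - a * hyp0F1' a t"
    using E(2) by (simp add: algebra_simps)
  ultimately have "(hyp0F1_logderiv a has_real_derivative
      ((hyp0F1' a t + (hyp0F1 a t - a * hyp0F1' a t)) * hyp0F1 a t - t * hyp0F1' a t * hyp0F1' a t)
        / (hyp0F1 a t * hyp0F1 a t)) (at t)"
    by (simp add: hyp0F1_logderiv_def[abs_def])
  then show ?thesis
    by (rule that) (use pos in \<open>simp add: hyp0F1_logderiv_def field_simps power2_eq_square\<close>)
qed

lemma hyp0F1_logderiv_deriv:
  assumes "t \<ge> 0"
  shows "(hyp0F1_logderiv a has_real_derivative deriv (hyp0F1_logderiv a) t) (at t)"
    and "t * deriv (hyp0F1_logderiv a) t
      = t + (1 - a) * hyp0F1_logderiv a t - (hyp0F1_logderiv a t)\<^sup>2"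
  using hyp0F1_logderiv_Riccati[OF assms] by (metis DERIV_imp_deriv)+

text \<open>With \<open>z = 2 sqrt t\<close>, the quotient \<open>\<phi> (\<phi> + a - 1) / t\<close> equals
  \<open>I\<^bsub>a-2\<^esub>(z) I\<^bsub>a\<^esub>(z) / I\<^bsub>a-1\<^esub>(z)\<^sup>2\<close>, so the next two bounds are Turan inequalities for Bessel functions.\<close>

lemma hyp0F1_logderiv_Turan_upper:
  assumes "a \<ge> 1" "t \<ge> 0"
  shows "hyp0F1_logderiv a t * (hyp0F1_logderiv a t + a - 1) \<le> t"
proof -
  let ?\<phi> = "hyp0F1_logderiv a"
  define P where "P t = t - ?\<phi> t * (?\<phi> t + a - 1)" for t
  define P' where "P' t = 1 - (2 * ?\<phi> t + a - 1) * deriv ?\<phi> t" for t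
  have "P t \<ge> 0"
  proof (rule nonneg_if_deriv_nonneg_when_neg[where f = P and f' = P'])
    show "(P has_real_derivative P' s) (at s)" if "s \<ge> 0" for s
      unfolding P_def[abs_def] P'_def using hyp0F1_logderiv_deriv(1)[OF that]
      by (auto intro!: derivative_eq_intros simp: algebra_simps)
    show "P' s \<ge> 0" if "s > 0" "P s < 0" for s
    proof -
      have "s * P' s = s - (2 * ?\<phi> s + a - 1) * (s * deriv ?\<phi> s)"
        by (simp add: P'_def algebra_simps)
      \<comment> \<open>By the Riccati equation \<open>s * deriv ?\<phi> s\<close> is
        \<open>P s\<close> itself: the bound says that \<phi> is nondecreasing.\<close>
      also have "\<dots> = s - (2 * ?\<phi> s + a - 1) * P s"
        unfolding hyp0F1_logderiv_deriv(2)[OF less_imp_le[OF \<open>s > 0\<close>]]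
        by (simp add: P_def algebra_simps power2_eq_square)
      finally have "s * P' s = s - (2 * ?\<phi> s + a - 1) * P s" .
      moreover have "(2 * ?\<phi> s + a - 1) * P s \<le> 0"
        using that assms hyp0F1_logderiv_nonneg[of s] by (auto intro: mult_nonneg_nonpos)
      ultimately have "s * P' s \<ge> 0"
        using \<open>s > 0\<close> by linarith
      then show ?thesis
        using \<open>s > 0\<close> by (simp add: zero_le_mult_iff)
    qed
  qed (use assms in \<open>auto simp: P_def\<close>)
  then show ?thesis
    by (simp add: P_def)
qed

lemma hyp0F1_logderiv_Turan_lower:
  assumes "a \<ge> 1" "t \<ge> 0"
  shows "(a - 1) * t \<le> a * hyp0F1_logderiv a t * (hyp0F1_logderiv a t + a - 1)"
proof -
  let ?\<phi> = "hyp0F1_logderiv a"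
  define U where "U t = a * ?\<phi> t * (?\<phi> t + a - 1) - (a - 1) * t" for t
  define U' where "U' t = a * (2 * ?\<phi> t + a - 1) * deriv ?\<phi> t - (a - 1)" for t
  have "U t \<ge> 0"
  proof (rule nonneg_if_deriv_nonneg_when_neg[where f = U and f' = U'])
    show "(U has_real_derivative U' s) (at s)" if "s \<ge> 0" for s
      unfolding U_def[abs_def] U'_def using hyp0F1_logderiv_deriv(1)[OF that]
      by (auto intro!: derivative_eq_intros simp: algebra_simps)
    show "U' s \<ge> 0" if "s > 0" "U s < 0" for s
    proof -
      have "s * U' s = a * (2 * ?\<phi> s + a - 1) * (s * deriv ?\<phi> s) - (a - 1) * s"
        by (simp add: U'_def algebra_simps)
      \<comment> \<open>The Riccati equation now reads
        \<open>a * (s * deriv ?\<phi> s) = s - U s\<close>.\<close>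
      also have "\<dots> = 2 * ?\<phi> s * s - (2 * ?\<phi> s + a - 1) * U s"
        unfolding hyp0F1_logderiv_deriv(2)[OF less_imp_le[OF \<open>s > 0\<close>]]
        by (simp add: U_def algebra_simps power2_eq_square)
      finally have "s * U' s = 2 * ?\<phi> s * s - (2 * ?\<phi> s + a - 1) * U s" .
      moreover have "2 * ?\<phi> s * s \<ge> 0" "(2 * ?\<phi> s + a - 1) * U s \<le> 0"
        using that assms hyp0F1_logderiv_nonneg[of s] by (auto intro: mult_nonneg_nonpos)
      ultimately have "s * U' s \<ge> 0"
        by linarith
      then show ?thesis
        using \<open>s > 0\<close> by (simp add: zero_le_mult_iff)
    qed
  qed (use assms in \<open>auto simp: U_def\<close>)
  then show ?thesis
    by (simp add: U_def)
qed

text \<open>The sign of this polynomial compares \<open>I\<^bsub>a\<^esub>(z) / I\<^bsub>a-1\<^esub>(z) = 2 \<phi> / z\<close> with the Amos-type bound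
  \<open>(sqrt (z\<^sup>2 + (a - 3/2)\<^sup>2) - (a - 1/2)) / z\<close>.\<close>

lemma DERIV_Amos_polynomial:
  fixes Q
  defines "Q \<equiv> (\<lambda>t. (hyp0F1_logderiv a t + a - 1) * (hyp0F1_logderiv a t + 1 / 2) - t)"
  assumes "t \<ge> 0"
  obtains D where "(Q has_real_derivative D) (at t)"
    and "t * D = (a - 3 / 2) / 2 * (hyp0F1_logderiv a t + a - 1)
      - (2 * hyp0F1_logderiv a t + a - 3 / 2) * Q t"
proof
  let ?\<phi> = "hyp0F1_logderiv a"
  define D where "D = (2 * ?\<phi> t + a - 1 / 2) * deriv ?\<phi> t - 1"
  show "(Q has_real_derivative D) (at t)"
    unfolding Q_def D_def using hyp0F1_logderiv_deriv(1)[OF \<open>t \<ge> 0\<close>]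
    by (auto intro!: derivative_eq_intros simp: algebra_simps)
  have "t * D = (2 * ?\<phi> t + a - 1 / 2) * (t * deriv ?\<phi> t) - t"
    by (simp add: D_def algebra_simps)
  \<comment> \<open>For a general shift \<open>c\<close> in place of \<open>1 / 2\<close>, the
    factor of \<open>?\<phi> t + a - 1\<close> would be
    \<open>(2 * c - 1) * ?\<phi> t + c * (a + c - 2)\<close>. The choice \<open>c = 1 / 2\<close>
    makes it constant.\<close>
  then show "t * D = (a - 3 / 2) / 2 * (?\<phi> t + a - 1) - (2 * ?\<phi> t + a - 3 / 2) * Q t"
    unfolding hyp0F1_logderiv_deriv(2)[OF \<open>t \<ge> 0\<close>]
    by (simp add: Q_def field_simps power2_eq_square)
qed

text \<open>\<open>Q\<close> starts at \<open>(a - 1) / 2 > 0\<close>, and at a zero its slope has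
  the sign of \<open>(a - 3 / 2) * (?\<phi> s + a - 1)\<close>, which is positive.\<close>

lemma hyp0F1_logderiv_Amos_lower:
  assumes "a > 3 / 2" "t \<ge> 0"
  shows "t < (hyp0F1_logderiv a t + a - 1) * (hyp0F1_logderiv a t + 1 / 2)"
proof -
  let ?\<phi> = "hyp0F1_logderiv a"
  define Q where "Q t = (?\<phi> t + a - 1) * (?\<phi> t + 1 / 2) - t" for t
  have deriv: "(Q has_real_derivative deriv Q s) (at s)"
    "s * deriv Q s = (a - 3 / 2) / 2 * (?\<phi> s + a - 1) - (2 * ?\<phi> s + a - 3 / 2) * Q s"
    if "s \<ge> 0" for s
    using DERIV_Amos_polynomial[OF that] unfolding Q_def[abs_def, symmetric]
    by (metis DERIV_imp_deriv Q_def)+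
  have "Q t > 0"
  proof (rule pos_if_deriv_pos_at_zeros[where f = Q and f' = "deriv Q"])
    show "deriv Q s > 0" if "s > 0" "Q s = 0" for s
    proof -
      have "(a - 3 / 2) / 2 * (?\<phi> s + a - 1) > 0"
        using that assms hyp0F1_logderiv_nonneg[of s] by (intro mult_pos_pos) auto
      then have "s * deriv Q s > 0"
        using deriv(2)[of s] that by simp
      then show ?thesis
        using \<open>s > 0\<close> by (simp add: zero_less_mult_iff)
    qed
  qed (use assms deriv in \<open>auto simp: Q_def\<close>)
  then show ?thesis
    by (simp add: Q_def)
qed

text \<open>Now \<open>Q\<close> starts at \<open>(a - 1) / 2 < 0\<close>. The factor
  \<open>?\<phi> s + a - 1\<close> is negative at 0, but at a zero \<open>s > 0\<close> of
  \<open>Q\<close> its product with a positive factor equals \<open>s\<close>. It is thus positive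
  there, and \<open>Q\<close> could only cross downwards.\<close>

lemma hyp0F1_logderiv_Amos_upper:
  assumes "a < 1" "t \<ge> 0"
  shows "(hyp0F1_logderiv a t + a - 1) * (hyp0F1_logderiv a t + 1 / 2) < t"
proof -
  let ?\<phi> = "hyp0F1_logderiv a"
  define Q where "Q t = (?\<phi> t + a - 1) * (?\<phi> t + 1 / 2) - t" for t
  have deriv: "(Q has_real_derivative deriv Q s) (at s)"
    "s * deriv Q s = (a - 3 / 2) / 2 * (?\<phi> s + a - 1) - (2 * ?\<phi> s + a - 3 / 2) * Q s"
    if "s \<ge> 0" for s
    using DERIV_Amos_polynomial[OF that] unfolding Q_def[abs_def, symmetric]
    by (metis DERIV_imp_deriv Q_def)+
  have "- Q t > 0"
  proof (rule pos_if_deriv_pos_at_zeros[where f = "\<lambda>s. - Q s" and f' = "\<lambda>s. - deriv Q s"])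
    show "- deriv Q s > 0" if "s > 0" "- Q s = 0" for s
    proof -
      have "(?\<phi> s + a - 1) * (?\<phi> s + 1 / 2) > 0"
        using that by (simp add: Q_def)
      then have "?\<phi> s + a - 1 > 0"
        using \<open>s > 0\<close> hyp0F1_logderiv_nonneg[of s] unfolding zero_less_mult_iff by linarith
      then have "(a - 3 / 2) / 2 * (?\<phi> s + a - 1) < 0"
        using assms by (intro mult_neg_pos) auto
      then have "s * deriv Q s < 0"
        using deriv(2)[of s] that by simp
      then show ?thesis
        using \<open>s > 0\<close> by (simp add: mult_less_0_iff)
    qed
    show "((\<lambda>s. - Q s) has_real_derivative - deriv Q s) (at s)" if "s \<ge> 0" for s
      using DERIV_minus[OF deriv(1)[OF that]] .
  qed (use assms in \<open>auto simp: Q_def\<close>)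
  then show ?thesis
    by (simp add: Q_def)
qed

end

subsection \<open>Stationary points of the density\<close>

definition nc_chi2_kernel :: "real \<Rightarrow> real \<Rightarrow> real \<Rightarrow> real" where
  "nc_chi2_kernel a l y = exp (- y) * y powr (a - 1) * hyp0F1 a (l * y)"

text \<open>The identity \<open>Gamma (a + k) = Gamma a * pochhammer a k\<close> turns the mixture
  into the series of \<open>hyp0F1\<close>. The remaining factor is positive and free of
  \<open>x\<close>, so local maxima carry over.\<close>

lemma nc_chi2_density_eq_kernel:
  assumes "\<nu> > 0" "x > 0"
  shows "nc_chi2_density \<nu> lam x
    = exp (- lam / 2) / (2 * Gamma (\<nu> / 2)) * nc_chi2_kernel (\<nu> / 2) (lam / 2) (x / 2)"
proof -
  define a where "a = \<nu> / 2"
  define C where "C = exp (- lam / 2) * exp (- x / 2) * (x / 2) powr (a - 1) / (2 * Gamma a)"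
  have "a > 0"
    using assms by (simp add: a_def)
  have "exp (- lam / 2) / fact k * (lam / 2) ^ k * chi2_density (\<nu> + 2 * real k) x
      = C * (hyp0F1_coeff a k * (lam / 2 * (x / 2)) ^ k)" for k
  proof -
    have half: "(\<nu> + 2 * real k) / 2 = a + real k"
      by (simp add: a_def field_simps)
    have "a \<notin> \<int>\<^sub>\<le>\<^sub>0"
      using \<open>a > 0\<close> by (auto elim!: nonpos_Ints_cases)
    then have "Gamma (a + real k) = Gamma a * pochhammer a k"
      using pochhammer_Gamma[of a k] Gamma_real_pos[OF \<open>a > 0\<close>] by (simp add: field_simps)
    moreover have "(x / 2) powr (a + real k - 1) = (x / 2) powr (a - 1) * (x / 2) ^ k"
    proof -
      have "a + real k - 1 = (a - 1) + real k"
        by simp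
      then show ?thesis
        using \<open>x > 0\<close> by (simp only: powr_add) (simp add: powr_realpow)
    qed
    ultimately show ?thesis
      unfolding chi2_density_def half
      unfolding C_def hyp0F1_coeff_def power_mult_distrib by (simp add: mult_ac)
  qed
  then have "nc_chi2_density \<nu> lam x = C * hyp0F1 a (lam / 2 * (x / 2))"
    unfolding nc_chi2_density_def hyp0F1_def
    by (simp only: suminf_mult[OF summable_hyp0F1[OF \<open>a > 0\<close>]])
  then show ?thesis
    by (simp add: C_def nc_chi2_kernel_def a_def)
qed

lemma interior_mode_kernel:
  assumes "\<nu> > 0" "interior_mode \<nu> lam M"
  obtains d where "d > 0"
    and "\<And>y. \<bar>M / 2 - y\<bar> < d \<Longrightarrow> y > 0 \<and>
      nc_chi2_kernel (\<nu> / 2) (lam / 2) y \<le> nc_chi2_kernel (\<nu> / 2) (lam / 2) (M / 2)"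
proof -
  have "M > 0" and "\<forall>\<^sub>F x in at M within {0<..}. nc_chi2_density \<nu> lam x \<le> nc_chi2_density \<nu> lam M"
    using assms(2) by (auto simp: interior_mode_def)
  then obtain e where "e > 0" and e: "\<And>x. x > 0 \<Longrightarrow> x \<noteq> M \<Longrightarrow> dist x M < e \<Longrightarrow>
      nc_chi2_density \<nu> lam x \<le> nc_chi2_density \<nu> lam M"
    by (auto simp: eventually_at)
  show ?thesis
  proof
    \<comment> \<open>The half comes from \<open>y = x / 2\<close>; the cap \<open>M\<close> keeps
      \<open>y\<close> positive.\<close>
    show "min e M / 2 > 0"
      using \<open>e > 0\<close> \<open>M > 0\<close> by simp
    fix y assume y: "\<bar>M / 2 - y\<bar> < min e M / 2"
    then have "y > 0"
      by linarith
    have "nc_chi2_density \<nu> lam (2 * y) \<le> nc_chi2_density \<nu> lam M"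
    proof (cases "2 * y = M")
      case False
      moreover have "\<bar>2 * y - M\<bar> < e"
        using y by linarith
      ultimately show ?thesis
        using e[of "2 * y"] \<open>y > 0\<close> by (simp add: dist_real_def)
    qed simp
    moreover have "exp (- lam / 2) / (2 * Gamma (\<nu> / 2)) > 0"
      using assms(1) by (simp add: Gamma_real_pos)
    ultimately show "y > 0 \<and>
        nc_chi2_kernel (\<nu> / 2) (lam / 2) y \<le> nc_chi2_kernel (\<nu> / 2) (lam / 2) (M / 2)"
      using nc_chi2_density_eq_kernel[OF assms(1)] \<open>y > 0\<close> \<open>M > 0\<close>
      by (simp add: mult_le_cancel_left_pos del: times_divide_eq_left)
  qed
qed

lemma DERIV_nc_chi2_kernel:
  assumes "a > 0" "l \<ge> 0" "y > 0"
  shows "(nc_chi2_kernel a l has_real_derivative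
    nc_chi2_kernel a l y * (hyp0F1_logderiv a (l * y) + a - 1 - y) / y) (at y)"
proof -
  have "hyp0F1 a (l * y) > 0"
    using hyp0F1_pos assms by simp
  have "((\<lambda>y. hyp0F1 a (l * y)) has_real_derivative hyp0F1' a (l * y) * l) (at y)"
    by (rule DERIV_chain2[OF DERIV_hyp0F1[OF assms(1)]]) (auto intro!: derivative_eq_intros)
  moreover have "((\<lambda>y. y powr (a - 1)) has_real_derivative (a - 1) * (y powr (a - 1) / y)) (at y)"
    using has_real_derivative_powr[OF \<open>y > 0\<close>, of "a - 1"] powr_diff[of y "a - 1" 1] \<open>y > 0\<close> by simp
  moreover have "((\<lambda>y. exp (- y)) has_real_derivative - exp (- y)) (at y)"
    by (auto intro!: derivative_eq_intros)
  ultimately have "(nc_chi2_kernel a l has_real_derivative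
      exp (- y) * y powr (a - 1) * (hyp0F1' a (l * y) * l)
      + (exp (- y) * ((a - 1) * (y powr (a - 1) / y)) + - exp (- y) * y powr (a - 1))
        * hyp0F1 a (l * y)) (at y)"
    unfolding nc_chi2_kernel_def[abs_def] by (intro DERIV_mult')
  then show ?thesis
    by (elim DERIV_cong)
      (use \<open>y > 0\<close> \<open>hyp0F1 a (l * y) > 0\<close> in
        \<open>simp add: nc_chi2_kernel_def hyp0F1_logderiv_def field_simps\<close>)
qed

lemma nc_chi2_kernel_pos:
  assumes "a > 0" "l \<ge> 0" "y > 0"
  shows "nc_chi2_kernel a l y > 0"
  using assms hyp0F1_pos by (simp add: nc_chi2_kernel_def)

text \<open>The usual second-order condition gives only \<open>l + a - 2 <= m\<close>; excluding
  equality takes one more derivative.\<close>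

lemma nc_chi2_kernel_local_max:
  assumes "a > 0" "l \<ge> 0" "d > 0"
    and max: "\<And>y. \<bar>m - y\<bar> < d \<Longrightarrow> y > 0 \<and> nc_chi2_kernel a l y \<le> nc_chi2_kernel a l m"
  shows "hyp0F1_logderiv a (l * m) + a - 1 = m" and "l + a - 2 < m"
proof -
  define \<psi> where "\<psi> y = hyp0F1_logderiv a (l * y) + a - 1 - y" for y
  have "m > 0"
    using max[of m] \<open>d > 0\<close> by simp
  have kernel: "(nc_chi2_kernel a l has_real_derivative nc_chi2_kernel a l y * \<psi> y / y) (at y)"
      "nc_chi2_kernel a l y > 0" if "y > 0" for y
    using DERIV_nc_chi2_kernel nc_chi2_kernel_pos assms that by (auto simp: \<psi>_def)
  have "nc_chi2_kernel a l m * \<psi> m / m = 0"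
    by (rule DERIV_local_max[OF kernel(1) \<open>d > 0\<close>]) (use \<open>m > 0\<close> max in auto)
  then have "\<psi> m = 0"
    using kernel(2)[of m] \<open>m > 0\<close> by simp
  then show "hyp0F1_logderiv a (l * m) + a - 1 = m"
    by (simp add: \<psi>_def)

  \<comment> \<open>This is the Riccati equation rewritten for \<psi>. Where \<psi> vanishes, only
    \<open>y * (l + a - 2 - y)\<close> survives.\<close>
  define h where "h y = y * (l + a - 2 - y) - (2 * y - a + 1) * \<psi> y - (\<psi> y)\<^sup>2" for y
  have deriv: "(\<psi> has_real_derivative h y / y) (at y)" if "y > 0" for y
  proof -
    have "l * y \<ge> 0"
      using that assms by simp
    note \<phi> = hyp0F1_logderiv_deriv[OF assms(1) this]
    have "((\<lambda>y. hyp0F1_logderiv a (l * y)) has_real_derivative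
        deriv (hyp0F1_logderiv a) (l * y) * l) (at y)"
      by (rule DERIV_chain2[where g = "\<lambda>y. l * y", OF \<phi>(1)]) (auto intro!: derivative_eq_intros)
    then have "(\<psi> has_real_derivative deriv (hyp0F1_logderiv a) (l * y) * l - 1) (at y)"
      unfolding \<psi>_def[abs_def] by (auto intro!: derivative_eq_intros)
    moreover have "(deriv (hyp0F1_logderiv a) (l * y) * l - 1) * y = h y"
      using \<phi>(2) by (simp add: h_def \<psi>_def algebra_simps power2_eq_square)
    then have "deriv (hyp0F1_logderiv a) (l * y) * l - 1 = h y / y"
      using that by (simp add: eq_divide_eq)
    ultimately show ?thesis
      by simp
  qed

  \<comment> \<open>If \<psi> were negative just left of \<open>m\<close>, the kernel would strictly
    decrease towards \<open>m\<close>, against maximality.\<close>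
  have not_increasing: False
    if "e > 0" and neg: "\<And>y. m - e < y \<Longrightarrow> y < m \<Longrightarrow> \<psi> y < 0" for e
  proof -
    define u where "u = m - min d e / 2"
    have u: "\<bar>m - u\<bar> < d" "m - e < u" "u < m"
      using \<open>d > 0\<close> \<open>e > 0\<close> by (auto simp: u_def abs_if)
    have "u > 0"
      using max[OF u(1)] by simp
    obtain z where z: "u < z" "z < m"
        "nc_chi2_kernel a l m - nc_chi2_kernel a l u = (m - u) * (nc_chi2_kernel a l z * \<psi> z / z)"
      using MVT2[of u m "nc_chi2_kernel a l" "\<lambda>y. nc_chi2_kernel a l y * \<psi> y / y"]
        kernel(1) u \<open>u > 0\<close> by auto
    have "nc_chi2_kernel a l z * \<psi> z / z < 0"
      using neg[of z] z u \<open>u > 0\<close> kernel(2)[of z] by (simp add: divide_less_0_iff mult_less_0_iff)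
    then show False
      using z(3) u max[OF u(1)] mult_pos_neg[of "m - u"] by fastforce
  qed

  show "l + a - 2 < m"
  proof (rule ccontr)
    assume "\<not> l + a - 2 < m"
    then consider "m < l + a - 2" | "m = l + a - 2"
      by linarith
    then show False
    proof cases
      case 1
      then have "h m / m > 0"
        using \<open>m > 0\<close> \<open>\<psi> m = 0\<close> by (simp add: h_def)
      then obtain e where "e > 0" "\<And>r. r > 0 \<Longrightarrow> r < e \<Longrightarrow> \<psi> (m - r) < \<psi> m"
        using DERIV_pos_inc_left[OF deriv[OF \<open>m > 0\<close>]] by blast
      then show False
        using not_increasing[of e] \<open>\<psi> m = 0\<close>
        by (metis add.commute diff_diff_eq2 add_diff_cancel_left' diff_gt_0_iff_gt less_diff_eq)
    next
      case 2
      then have "h m = 0"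
        using \<open>\<psi> m = 0\<close> by (simp add: h_def)
      have "(\<psi> has_real_derivative 0) (at m)"
        using deriv[OF \<open>m > 0\<close>] \<open>h m = 0\<close> by simp
      \<comment> \<open>Both \<psi> and its derivative vanish at \<open>m\<close>, so only
        \<open>y * (m - y)\<close> contributes to the slope of \<open>h\<close>. Hence
        \<open>h > 0\<close> just left of \<open>m\<close>, where \<psi> then increases to its
        zero.\<close>
      then have "(h has_real_derivative - m) (at m)"
        unfolding h_def[abs_def]
        by (auto intro!: derivative_eq_intros simp: \<open>\<psi> m = 0\<close> simp flip: 2)
      then obtain e where "e > 0" and e: "\<And>r. r > 0 \<Longrightarrow> r < e \<Longrightarrow> h m < h (m - r)"
        using DERIV_neg_dec_left[of h "- m" m] \<open>m > 0\<close> by auto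
      show False
      proof (rule not_increasing)
        show "min e m > 0"
          using \<open>e > 0\<close> \<open>m > 0\<close> by simp
        fix y assume y: "m - min e m < y" "y < m"
        obtain z where z: "y < z" "z < m" "\<psi> m - \<psi> y = (m - y) * (h z / z)"
          using MVT2[of y m \<psi> "\<lambda>y. h y / y"] deriv y by auto
        have "h z / z > 0"
          using e[of "m - z"] z y \<open>h m = 0\<close> by (auto simp: min_def split: if_splits)
        then have "(m - y) * (h z / z) > 0"
          using y by (intro mult_pos_pos) auto
        then show "\<psi> y < 0"
          using z(3) \<open>\<psi> m = 0\<close> by simp
      qed
    qed
  qed
qed

theorem proposition3:
  fixes \<nu> lam M :: real
  assumes "\<nu> > 0" and "lam \<ge> 0" and "interior_mode \<nu> lam M"
  shows "lam + \<nu> - 4 < M \<and>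
    (\<nu> \<ge> 2 \<longrightarrow> (\<nu> - 2) * (1 + lam / \<nu>) \<le> M \<and> M \<le> lam + \<nu> - 2) \<and>
    (\<nu> > 3 \<longrightarrow> lam + \<nu> - 3 < M) \<and>
    (\<nu> < 2 \<and> lam > crit_value \<nu> \<longrightarrow> M < lam + \<nu> - 3)"
proof -
  define a l m where "a = \<nu> / 2" and "l = lam / 2" and "m = M / 2"
  have eqs: "\<nu> = 2 * a" "lam = 2 * l" "M = 2 * m"
    by (simp_all add: a_def l_def m_def)
  have "a > 0" "l \<ge> 0" "m > 0"
    using assms by (auto simp: a_def l_def m_def interior_mode_def)
  obtain d where "d > 0" and
    "\<And>y. \<bar>m - y\<bar> < d \<Longrightarrow> y > 0 \<and> nc_chi2_kernel a l y \<le> nc_chi2_kernel a l m"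
    using interior_mode_kernel[OF assms(1,3)] unfolding a_def l_def m_def by metis
  note mode = nc_chi2_kernel_local_max[OF \<open>a > 0\<close> \<open>l \<ge> 0\<close> this]
  \<comment> \<open>Stationarity turns \<open>\<phi> + a - 1\<close> into \<open>m\<close>, so both
    sides of each quadratic bound at \<open>l * m\<close> contain the factor \<open>m\<close>.
    Cancelling it leaves a bound linear in \<open>m\<close>.\<close>
  have \<phi>: "hyp0F1_logderiv a (l * m) = m - a + 1"
    using mode(1) by simp
  have "l * m \<ge> 0"
    using \<open>l \<ge> 0\<close> \<open>m > 0\<close> by simp
  have "m \<le> l + a - 1" "(2 * a - 2) * (1 + l / a) \<le> 2 * m" if "a \<ge> 1"
  proof -
    have "(m - a + 1) * m \<le> l * m"
      using hyp0F1_logderiv_Turan_upper[OF \<open>a > 0\<close> that \<open>l * m \<ge> 0\<close>] by (simp add: \<phi>)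
    then show "m \<le> l + a - 1"
      using \<open>m > 0\<close> by simp
    have "((a - 1) * l) * m \<le> (a * (m - a + 1)) * m"
      using hyp0F1_logderiv_Turan_lower[OF \<open>a > 0\<close> that \<open>l * m \<ge> 0\<close>] by (simp add: \<phi> mult.assoc)
    then have "(a - 1) * l \<le> a * (m - a + 1)"
      using \<open>m > 0\<close> by simp
    then show "(2 * a - 2) * (1 + l / a) \<le> 2 * m"
      using \<open>a > 0\<close> by (simp add: field_simps)
  qed
  moreover have "l + a - 3 / 2 < m" if "a > 3 / 2"
  proof -
    have "l * m < (m - a + 3 / 2) * m"
      using hyp0F1_logderiv_Amos_lower[OF \<open>a > 0\<close> that \<open>l * m \<ge> 0\<close>] by (simp add: \<phi> algebra_simps)
    then show ?thesis
      using \<open>m > 0\<close> by simp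
  qed
  moreover have "m < l + a - 3 / 2" if "a < 1"
  proof -
    have "(m - a + 3 / 2) * m < l * m"
      using hyp0F1_logderiv_Amos_upper[OF \<open>a > 0\<close> that \<open>l * m \<ge> 0\<close>] by (simp add: \<phi> algebra_simps)
    then show ?thesis
      using \<open>m > 0\<close> by simp
  qed
  ultimately show ?thesis
    using mode(2) unfolding eqs by auto
qed

end
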